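(* Let $G$ be a graph with vertex set $[n]$ given by a stream of distinct edges, let $d_v$ be the degree of $v$, and run tail sampling (see context) with parameter $p_t\in(0,1)$, producing a set $S_t$ and counters $\mathrm{ct}_t$. For every $v\in[n]$, $v$ is inserted in $S_t$ independently (over $v$) with probability $1-(1-p_t)^{d_v}$. Conditioned on $v\in S_t$, $\mathrm{ct}_t(v)=d_v-X$, where $X\sim\mathrm{TG}_{p_t,d_v}$.
   Context: The input is a stream of edges with no repetitions, in arbitrary order, each edge a pair of distinct vertices; $G=(V,E)$ with $V=[n]$ is the graph they form, where every vertex occurs in some edge. Tail sampling. Start with $S_t=\emptyset$. For each edge $(u,v)$ of the stream, for $w=u$ and then $w=v$: if $w\in S_t$, increment the counter $\mathrm{ct}_t(w)$; if $w\notin S_t$, then with probability $p_t$, by a fresh independent coin, insert $w$ in $S_t$ and set $\mathrm{ct}_t(w)=1$. $\mathrm{ct}_t(v)$ in the claim denotes the value at the end of the stream. Truncated geometric distribution. For a positive integer $s$ and $p\in(0,1)$, $\mathrm{TG}_{p,s}$ is the distribution on $\{0,1,\dots,s-1\}$ with $\Pr[X=k]=p(1-p)^k/[1-(1-p)^s]$ for $0\le k\le s-1$. *)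

theory Defs
  imports "HOL-Probability.Probability"
begin

definition undirected :: "nat \<times> nat \<Rightarrow> nat set" where
  "undirected e = {fst e, snd e}"

text \<open>Edges are undirected, so (u, v) and (v, u) count as a repetition.\<close>

definition edge_stream :: "nat \<Rightarrow> (nat \<times> nat) list \<Rightarrow> bool" where
  "edge_stream n es \<longleftrightarrow>
     (\<forall>(u, v) \<in> set es. u \<in> {1..n} \<and> v \<in> {1..n} \<and> u \<noteq> v) \<and>
     distinct (map undirected es) \<and>
     (\<forall>v \<in> {1..n}. \<exists>e \<in> set es. v \<in> undirected e)"

definition edges :: "(nat \<times> nat) list \<Rightarrow> nat set set" where
  "edges es = undirected ` set es"

definition edge_degree :: "nat set set \<Rightarrow> nat \<Rightarrow> nat" where
  "edge_degree E v = card {e \<in> E. v \<in> e}"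

text \<open>A state is the sampled set together with the counters; the value of a counter
  outside the sampled set carries no meaning (it is 0 initially and is set to 1 on insertion).\<close>

type_synonym tail_state = "nat set \<times> (nat \<Rightarrow> nat)"

definition tail_vertex :: "real \<Rightarrow> nat \<Rightarrow> tail_state \<Rightarrow> tail_state pmf" where
  "tail_vertex p w = (\<lambda>(S, ct).
     if w \<in> S then return_pmf (S, ct(w := ct w + 1))
     else map_pmf (\<lambda>b. if b then (insert w S, ct(w := 1)) else (S, ct)) (bernoulli_pmf p))"

definition tail_edge :: "real \<Rightarrow> nat \<times> nat \<Rightarrow> tail_state \<Rightarrow> tail_state pmf" where
  "tail_edge p = (\<lambda>(u, v) st. bind_pmf (tail_vertex p u st) (tail_vertex p v))"

primrec tail_run :: "real \<Rightarrow> (nat \<times> nat) list \<Rightarrow> tail_state \<Rightarrow> tail_state pmf" where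
  "tail_run p [] st = return_pmf st"
| "tail_run p (e # es) st = bind_pmf (tail_edge p e st) (tail_run p es)"

definition tail_sampling :: "real \<Rightarrow> (nat \<times> nat) list \<Rightarrow> tail_state pmf" where
  "tail_sampling p es = tail_run p es ({}, \<lambda>_. 0)"

definition trunc_geometric_pmf :: "real \<Rightarrow> nat \<Rightarrow> nat pmf" where
  "trunc_geometric_pmf p s =
     embed_pmf (\<lambda>k. if k < s then p * (1 - p) ^ k / (1 - (1 - p) ^ s) else 0)"

text \<open>The definition by embed_pmf is meaningful only if the given function sums to 1.\<close>

lemma pmf_trunc_geometric:
  assumes "0 < p" "p < 1" "0 < s"
  shows "pmf (trunc_geometric_pmf p s) k =
           (if k < s then p * (1 - p) ^ k / (1 - (1 - p) ^ s) else 0)"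
proof -
  let ?f = "\<lambda>k. if k < s then p * (1 - p) ^ k / (1 - (1 - p) ^ s) else (0 :: real)"
  have pos: "1 - (1 - p) ^ s > 0"
    using assms by (simp add: power_less_one_iff)
  have nonneg: "?f k \<ge> 0" for k
    using assms pos by simp
  have "(\<Sum>k<s. p * (1 - p) ^ k) = 1 - (1 - p) ^ s"
    using one_diff_power_eq[of "1 - p" s] by (simp add: sum_distrib_left)
  hence sum1: "(\<Sum>k<s. ?f k) = 1"
    using pos by (simp add: sum_divide_distrib[symmetric])
  have "(\<integral>\<^sup>+k. ennreal (?f k) \<partial>count_space UNIV) = (\<Sum>k<s. ennreal (?f k))"
    by (rule nn_integral_count_space') auto
  also have "\<dots> = ennreal (\<Sum>k<s. ?f k)"
    by (rule sum_ennreal) (rule nonneg)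
  also have "\<dots> = 1"
    by (simp only: sum1 ennreal_1)
  finally show ?thesis
    unfolding trunc_geometric_pmf_def by (subst pmf_embed_pmf) (auto simp only: nonneg)
qed

end

theory Submission imports Defs begin

text \<open>On every reachable state a vertex is sampled iff its counter is positive, so the counters
  alone determine the state. Each occurrence of a vertex moves only its own counter, by a fixed
  Markov kernel; starting from a product distribution, the counters therefore remain independent,
  and the counter of \<open>v\<close> is the chain after \<open>d v\<close> steps. If the coin first succeeds at
  step \<open>X + 1\<close>, where \<open>X < d v\<close>, the counter ends at \<open>d v - X\<close>.\<close>

section \<open>Counters as independent Markov chains\<close>

text \<open>The value 0 stands for a vertex not yet sampled, so the coin, read as 0 or 1, is itself
  the next counter value.\<close>

definition counter_step :: "real \<Rightarrow> nat \<Rightarrow> nat pmf" where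
  "counter_step p k =
     (if k > 0 then return_pmf (k + 1) else map_pmf of_bool (bernoulli_pmf p))"

text \<open>The chain acts on distributions rather than on values, so that one step can be absorbed
  into a factor of a product.\<close>

definition counter_iter :: "real \<Rightarrow> nat \<Rightarrow> nat pmf \<Rightarrow> nat pmf" where
  "counter_iter p m = ((\<lambda>q. bind_pmf q (counter_step p)) ^^ m)"

definition state_of :: "(nat \<Rightarrow> nat) \<Rightarrow> tail_state" where
  "state_of ct = ({w. ct w > 0}, ct)"

primrec vertex_run :: "real \<Rightarrow> nat list \<Rightarrow> tail_state \<Rightarrow> tail_state pmf" where
  "vertex_run p [] st = return_pmf st"
| "vertex_run p (w # ws) st = bind_pmf (tail_vertex p w st) (vertex_run p ws)"

definition vertex_stream :: "(nat \<times> nat) list \<Rightarrow> nat list" where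
  "vertex_stream es = concat (map (\<lambda>(u, v). [u, v]) es)"

text \<open>Associativity of bind: an edge is processed as its two endpoints in turn, so the pairing
  into edges can be forgotten.\<close>

lemma tail_run_eq_vertex_run: "tail_run p es st = vertex_run p (vertex_stream es) st"
proof (induction es arbitrary: st)
  case (Cons e es)
  show ?case
    by (cases e) (simp add: vertex_stream_def tail_edge_def bind_assoc_pmf
        Cons.IH[unfolded vertex_stream_def] cong: bind_pmf_cong)
qed (simp add: vertex_stream_def)

text \<open>Insertion turns a zero counter into 1 and an increment keeps a counter positive, so the
  sampled set remains the support of the counters.\<close>

lemma tail_vertex_state_of:
  "tail_vertex p w (state_of ct)
     = map_pmf (\<lambda>k. state_of (ct(w := k))) (counter_step p (ct w))"
proof (cases "ct w > 0")
  case True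
  then have "{x. x \<noteq> w \<longrightarrow> 0 < ct x} = {x. 0 < ct x}"
    by auto
  with True show ?thesis
    by (simp add: tail_vertex_def counter_step_def state_of_def)
next
  case False
  \<comment> \<open>The first set is the support after a successful coin. A failed coin writes 0
    over the 0 already there, which changes nothing.\<close>
  then have "{x. x \<noteq> w \<longrightarrow> 0 < ct x} = insert w {x. 0 < ct x}" "ct(w := 0) = ct"
    by auto
  with False show ?thesis
    by (auto simp: tail_vertex_def counter_step_def state_of_def map_pmf_comp
        intro!: map_pmf_cong)
qed

text \<open>Coordinate \<open>w\<close> is an independent factor, and the kernel \<open>K\<close>
  reads and writes only that factor.\<close>

lemma Pi_pmf_bind_component:
  assumes "finite A" and "w \<in> A"
  shows "bind_pmf (Pi_pmf A dflt q) (\<lambda>f. map_pmf (\<lambda>k. f(w := k)) (K (f w)))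
    = Pi_pmf A dflt (q(w := bind_pmf (q w) K))"
proof -
  define B where "B = A - {w}"
  have A: "A = insert w B" and B: "finite B" "w \<notin> B"
    using assms by (auto simp: B_def)
  have "Pi_pmf B dflt (q(w := bind_pmf (q w) K)) = Pi_pmf B dflt q"
    using B by (intro Pi_pmf_cong) auto
  then have "Pi_pmf A dflt (q(w := bind_pmf (q w) K))
    = map_pmf (\<lambda>(y, f). f(w := y)) (pair_pmf (bind_pmf (q w) K) (Pi_pmf B dflt q))"
    unfolding A by (subst Pi_pmf_insert[OF B]) simp
  also have "\<dots> = bind_pmf (q w) (\<lambda>x. bind_pmf (K x) (\<lambda>k.
      bind_pmf (Pi_pmf B dflt q) (\<lambda>f. return_pmf (f(w := k)))))"
    by (simp add: pair_pmf_def map_pmf_def bind_assoc_pmf bind_return_pmf)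
  \<comment> \<open>Neither draw uses the result of the other, so they commute. Drawing
    \<open>x\<close> and \<open>f\<close> first assembles the full product, whose entry
    \<open>x\<close> at \<open>w\<close> is then overwritten by \<open>k\<close>.\<close>
  also have "\<dots> = bind_pmf (q w) (\<lambda>x. bind_pmf (Pi_pmf B dflt q) (\<lambda>f.
      bind_pmf (K x) (\<lambda>k. return_pmf (f(w := k)))))"
    by (intro bind_pmf_cong refl bind_commute_pmf)
  also have "\<dots> = bind_pmf (Pi_pmf A dflt q) (\<lambda>f. map_pmf (\<lambda>k. f(w := k)) (K (f w)))"
    unfolding A Pi_pmf_insert[OF B]
    by (simp add: pair_pmf_def map_pmf_def bind_assoc_pmf bind_return_pmf)
  finally show ?thesis ..
qed

text \<open>The factors \<open>q\<close> stay arbitrary in the induction because the head of the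
  list replaces the factor at \<open>w\<close>, leaving a product again.\<close>

lemma vertex_run_Pi_pmf:
  assumes "finite A" and "set ws \<subseteq> A"
  shows "bind_pmf (Pi_pmf A 0 q) (\<lambda>ct. vertex_run p ws (state_of ct))
    = map_pmf state_of (Pi_pmf A 0 (\<lambda>v. counter_iter p (count_list ws v) (q v)))"
  using assms(2)
proof (induction ws arbitrary: q)
  case Nil
  show ?case
    by (simp add: counter_iter_def map_pmf_def)
next
  case (Cons w ws)
  let ?q = "q(w := bind_pmf (q w) (counter_step p))"
  have "bind_pmf (Pi_pmf A 0 q) (\<lambda>ct. vertex_run p (w # ws) (state_of ct))
    = bind_pmf (bind_pmf (Pi_pmf A 0 q)
        (\<lambda>ct. map_pmf (\<lambda>k. ct(w := k)) (counter_step p (ct w))))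
        (\<lambda>ct. vertex_run p ws (state_of ct))"
    by (simp add: tail_vertex_state_of bind_assoc_pmf bind_map_pmf)
  also have "\<dots> = bind_pmf (Pi_pmf A 0 ?q) (\<lambda>ct. vertex_run p ws (state_of ct))"
    using Cons.prems by (subst Pi_pmf_bind_component[OF assms(1)]) auto
  also have "\<dots> = map_pmf state_of (Pi_pmf A 0 (\<lambda>v. counter_iter p (count_list ws v) (?q v)))"
    using Cons.prems by (intro Cons.IH) auto
  \<comment> \<open>The step of the head acts first and is thus the innermost of the iterate, which
    is where \<open>funpow_Suc_right\<close> splits it off.\<close>
  also have "(\<lambda>v. counter_iter p (count_list ws v) (?q v))
    = (\<lambda>v. counter_iter p (count_list (w # ws) v) (q v))"
    by (auto simp: counter_iter_def funpow_Suc_right simp del: funpow.simps)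
  finally show ?case .
qed

text \<open>The initial state is \<open>state_of\<close> of the zero function, a product of point
  masses at 0; the default 0 makes this right outside \<open>A\<close> as well.\<close>

lemma tail_sampling_eq:
  assumes "finite A" and "set (vertex_stream es) \<subseteq> A"
  shows "tail_sampling p es = map_pmf state_of
    (Pi_pmf A 0 (\<lambda>v. counter_iter p (count_list (vertex_stream es) v) (return_pmf 0)))"
  using vertex_run_Pi_pmf[OF assms, of "\<lambda>_. return_pmf 0" p] assms(1)
  by (simp add: tail_sampling_def tail_run_eq_vertex_run state_of_def bind_return_pmf)

section \<open>The law of a single counter\<close>

text \<open>Every value has exactly one predecessor in the chain: 0 for the values 0 and 1, and
  \<open>k - 1\<close> for larger \<open>k\<close>.\<close>

lemma pmf_bind_counter_step:
  assumes "0 \<le> p" and "p \<le> 1"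
  shows "pmf (bind_pmf q (counter_step p)) k =
    (if k = 0 then (1 - p) * pmf q 0 else if k = 1 then p * pmf q 0 else pmf q (k - 1))"
proof -
  have of_bool: "map_pmf of_bool (bernoulli_pmf p) = bind_pmf (bernoulli_pmf p)
      (\<lambda>b. return_pmf (of_bool b :: nat))"
    by (simp add: map_pmf_def)
  \<comment> \<open>As a function of the predecessor \<open>x\<close>, the transition probability is
    a multiple of the indicator of one point, so integrating it gives a multiple of one point mass
    of \<open>q\<close>.\<close>
  have step: "pmf (counter_step p x) k = (if k = 0 then 1 - p else if k = 1 then p else 1)
      * indicator {if k = 0 then 0 else k - 1} x" for x
    using assms by (auto simp: counter_step_def of_bool pmf_bind indicator_def)
  show ?thesis
    unfolding pmf_bind step by (simp add: measure_pmf_single)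
qed

text \<open>A final value \<open>k > 0\<close> means \<open>m - k\<close> failures, one success and
  then \<open>k - 1\<close> forced increments.\<close>

lemma pmf_counter_iter:
  assumes "0 \<le> p" and "p \<le> 1"
  shows "pmf (counter_iter p m (return_pmf 0)) k =
    (if k = 0 then (1 - p) ^ m else if k \<le> m then p * (1 - p) ^ (m - k) else 0)"
proof (induction m arbitrary: k)
  case 0
  show ?case
    by (simp add: counter_iter_def)
next
  case (Suc m)
  have "counter_iter p (Suc m) (return_pmf 0)
    = bind_pmf (counter_iter p m (return_pmf 0)) (counter_step p)"
    by (simp add: counter_iter_def)
  then show ?case
    using Suc by (cases k) (auto simp: pmf_bind_counter_step[OF assms])
qed

lemma prob_counter_iter_pos:
  assumes "0 \<le> p" and "p \<le> 1"
  shows "measure_pmf.prob (counter_iter p m (return_pmf 0)) {0<..} = 1 - (1 - p) ^ m"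
proof -
  let ?N = "counter_iter p m (return_pmf 0)"
  have "{0<..} = - {0 :: nat}"
    by auto
  then have "measure_pmf.prob ?N {0<..} = 1 - measure_pmf.prob ?N {0}"
    using measure_pmf.prob_compl[of "{0}" ?N] by (simp add: Compl_eq_Diff_UNIV)
  then show ?thesis
    by (simp add: measure_pmf_single pmf_counter_iter[OF assms])
qed

text \<open>Lets conditioning pass through a map when the event depends only on the image; it serves
  both for \<open>state_of\<close> and for evaluation at a vertex.\<close>

lemma cond_map_pmf_vimage:
  assumes "set_pmf (map_pmf f N) \<inter> B \<noteq> {}"
  shows "map_pmf f (cond_pmf N (f -` B)) = cond_pmf (map_pmf f N) B"
  using assms by (subst cond_map_pmf) auto

text \<open>The probability of a positive counter is exactly the normalising constant of the
  truncated geometric law, and \<open>m - k\<close> is the number of failures before the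
  success.\<close>

lemma cond_counter_iter_pos:
  assumes "0 < p" and "p < 1" and "0 < m"
  shows "cond_pmf (counter_iter p m (return_pmf 0)) {0<..}
    = map_pmf (\<lambda>X. m - X) (trunc_geometric_pmf p m)"
proof (rule pmf_eqI)
  fix k
  let ?N = "counter_iter p m (return_pmf 0)" and ?T = "trunc_geometric_pmf p m"
  have p: "0 \<le> p" "p \<le> 1"
    using assms by auto
  have pos: "1 - (1 - p) ^ m > 0"
    using assms by (simp add: power_less_one_iff)
  have ne: "set_pmf ?N \<inter> {0<..} \<noteq> {}"
    using measure_pmf_zero_iff[of ?N "{0<..}"] pos by (simp add: prob_counter_iter_pos[OF p])
  \<comment> \<open>Subtraction on naturals would send every \<open>X \<ge> m\<close> to 0, so the
    support must stay below \<open>m\<close>.\<close>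
  have supp: "x < m" if "x \<in> set_pmf ?T" for x
    using that assms by (auto simp: set_pmf_iff pmf_trunc_geometric split: if_splits)
  have lhs: "pmf (cond_pmf ?N {0<..}) k
    = (if 0 < k \<and> k \<le> m then p * (1 - p) ^ (m - k) / (1 - (1 - p) ^ m) else 0)"
    by (simp add: pmf_cond[OF ne] prob_counter_iter_pos[OF p] pmf_counter_iter[OF p])
  show "pmf (cond_pmf ?N {0<..}) k = pmf (map_pmf (\<lambda>X. m - X) ?T) k"
  proof (cases "0 < k \<and> k \<le> m")
    case True
    have "pmf (map_pmf (\<lambda>X. m - X) ?T) k
      = measure_pmf.prob ?T ((\<lambda>X. m - X) -` {k})"
      by (simp add: pmf_map)
    \<comment> \<open>Since \<open>0 < k\<close>, no truncated difference equals \<open>k\<close>,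
      and the preimage is a single point.\<close>
    also have "(\<lambda>X. m - X) -` {k} = {m - k}"
      using True by auto
    finally show ?thesis
      using True assms by (simp add: lhs measure_pmf_single pmf_trunc_geometric)
  next
    case False
    then have "k \<notin> set_pmf (map_pmf (\<lambda>X. m - X) ?T)"
      using supp by fastforce
    then have "pmf (map_pmf (\<lambda>X. m - X) ?T) k = 0"
      by (simp only: set_pmf_iff not_not)
    with False show ?thesis
      by (simp only: lhs if_False)
  qed
qed

section \<open>Occurrences in the stream and degrees\<close>

text \<open>Without loops an edge contributes at most one occurrence of \<open>v\<close>, and
  without repetitions each list entry is a new element of the edge set.\<close>

lemma count_vertex_stream_eq_degree:
  assumes "\<forall>(u, v) \<in> set es. u \<noteq> v" and "distinct (map undirected es)"
  shows "count_list (vertex_stream es) v = edge_degree (edges es) v"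
  using assms
proof (induction es)
  case Nil
  show ?case
    by (simp add: vertex_stream_def edge_degree_def edges_def)
next
  case (Cons e es)
  have new: "undirected e \<notin> edges es"
    using Cons.prems by (auto simp: edges_def)
  have "{x \<in> edges (e # es). v \<in> x}
    = (if v \<in> undirected e then {undirected e} else {}) \<union> {x \<in> edges es. v \<in> x}"
    by (auto simp: edges_def)
  moreover have "finite (edges es)"
    by (simp add: edges_def)
  ultimately have "edge_degree (edges (e # es)) v
    = of_bool (v \<in> undirected e) + edge_degree (edges es) v"
    using new by (auto simp: edge_degree_def)
  moreover have "count_list (vertex_stream (e # es)) v
    = of_bool (v \<in> undirected e) + count_list (vertex_stream es) v"
    using Cons.prems by (cases e) (auto simp: vertex_stream_def undirected_def)
  ultimately show ?case
    using Cons by simp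
qed

theorem lemma2:
  fixes n :: nat and es :: "(nat \<times> nat) list" and p :: real
    and d :: "nat \<Rightarrow> nat" and M :: "tail_state pmf"
  assumes "edge_stream n es" and "0 < p" and "p < 1"
  defines "d \<equiv> edge_degree (edges es)" and "M \<equiv> tail_sampling p es"
  shows "(\<forall>v \<in> {1..n}. measure_pmf.prob M {(S, ct). v \<in> S} = 1 - (1 - p) ^ d v)
    \<and> prob_space.indep_events (measure_pmf M) (\<lambda>v. {(S, ct). v \<in> S}) {1..n}
    \<and> (\<forall>v \<in> {1..n}.
         map_pmf (\<lambda>(S, ct). int (ct v)) (cond_pmf M {(S, ct). v \<in> S})
           = map_pmf (\<lambda>X. int (d v) - int X) (trunc_geometric_pmf p (d v)))"
proof -
  define Q where "Q v = counter_iter p (d v) (return_pmf 0)" for v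
  define P where "P = Pi_pmf {1..n} 0 Q"
  let ?E = "\<lambda>v. {(S, ct). v \<in> S} :: tail_state set"
  have p: "0 \<le> p" "p \<le> 1"
    using assms by auto
  have "set (vertex_stream es) \<subseteq> {1..n}"
    using assms(1) by (fastforce simp: edge_stream_def vertex_stream_def)
  moreover have count: "count_list (vertex_stream es) v = d v" for v
    unfolding d_def using assms(1)
    by (intro count_vertex_stream_eq_degree) (auto simp: edge_stream_def)
  ultimately have M: "M = map_pmf state_of P"
    unfolding M_def P_def Q_def by (simp add: tail_sampling_eq[of "{1..n}"])
  \<comment> \<open>Being sampled is an event of the single coordinate \<open>v\<close>, which
    reduces all three claims to the product \<open>P\<close>.\<close>
  have E: "state_of -` ?E v = (\<lambda>ct. ct v) -` {0<..}" for v
    by (auto simp: state_of_def)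
  have component: "map_pmf (\<lambda>ct. ct v) P = Q v" if "v \<in> {1..n}" for v
    using that unfolding P_def by (subst Pi_pmf_component) auto
  have prob: "measure_pmf.prob M (?E v) = 1 - (1 - p) ^ d v" if "v \<in> {1..n}" for v
  proof -
    have "measure_pmf.prob M (?E v) = measure_pmf.prob (map_pmf (\<lambda>ct. ct v) P) {0<..}"
      by (simp only: M measure_map_pmf E)
    then show ?thesis
      by (simp only: component[OF that] Q_def prob_counter_iter_pos[OF p])
  qed
  have indep: "prob_space.indep_events (measure_pmf M) ?E {1..n}"
  proof (unfold prob_space.indep_events_def[OF prob_space_measure_pmf], intro conjI allI impI)
    fix J assume J: "J \<subseteq> {1..n}" "J \<noteq> {}" "finite J"
    have "state_of -` (\<Inter>v\<in>J. ?E v) = Pi J (\<lambda>_. {0<..})"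
      by (auto simp: state_of_def)
    \<comment> \<open>Padding with \<open>UNIV\<close> gives a box over all coordinates; the padded
      factors have probability 1 and drop out of the product.\<close>
    also have "\<dots> = Pi {1..n} (\<lambda>v. if v \<in> J then {0<..} else UNIV)"
      using J by (auto simp: Pi_def)
    finally have "measure_pmf.prob M (\<Inter>v\<in>J. ?E v)
      = (\<Prod>v\<in>{1..n}. measure_pmf.prob (Q v) (if v \<in> J then {0<..} else UNIV))"
      unfolding M P_def by (simp add: measure_Pi_pmf_Pi)
    also have "\<dots> = (\<Prod>v\<in>J. measure_pmf.prob (Q v) {0<..})"
      using J by (intro prod.mono_neutral_cong_right) auto
    also have "\<dots> = (\<Prod>v\<in>J. measure_pmf.prob M (?E v))"
      using J by (intro prod.cong refl) (auto simp: prob Q_def prob_counter_iter_pos[OF p])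
    finally show "measure_pmf.prob M (\<Inter>v\<in>J. ?E v) = (\<Prod>v\<in>J. measure_pmf.prob M (?E v))" .
  qed simp
  have cond: "map_pmf (\<lambda>(S, ct). int (ct v)) (cond_pmf M (?E v))
      = map_pmf (\<lambda>X. int (d v) - int X) (trunc_geometric_pmf p (d v))"
    if v: "v \<in> {1..n}" for v
  proof -
    \<comment> \<open>Every vertex lies on an edge, so \<open>d v > 0\<close>: the conditioning
      event has positive probability and the truncated geometric law is proper.\<close>
    from assms(1) v obtain e where "e \<in> set es" "v \<in> undirected e"
      unfolding edge_stream_def by blast
    then have "v \<in> set (vertex_stream es)"
      by (auto simp: vertex_stream_def undirected_def split_def)
    then have d: "0 < d v"
      using count_list_0_iff[of "vertex_stream es" v] by (simp add: count)
    have pos: "1 - (1 - p) ^ d v > 0"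
      using assms d by (simp add: power_less_one_iff)
    have ne: "set_pmf (Q v) \<inter> {0<..} \<noteq> {}"
      using measure_pmf_zero_iff[of "Q v" "{0<..}"] pos
      by (simp add: Q_def prob_counter_iter_pos[OF p])
    have "set_pmf M \<inter> ?E v \<noteq> {}"
      using measure_pmf_zero_iff[of M "?E v"] pos prob[OF v] by simp
    \<comment> \<open>The event is pulled back first along \<open>state_of\<close> and then along
      coordinate \<open>v\<close>, which brings the conditioning down to the single counter law
      \<open>Q v\<close>.\<close>
    then have "cond_pmf M (?E v) = map_pmf state_of (cond_pmf P ((\<lambda>ct. ct v) -` {0<..}))"
      unfolding M E[symmetric] by (rule cond_map_pmf_vimage[symmetric])
    then have "map_pmf (\<lambda>(S, ct). int (ct v)) (cond_pmf M (?E v))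
      = map_pmf int (map_pmf (\<lambda>ct. ct v) (cond_pmf P ((\<lambda>ct. ct v) -` {0<..})))"
      by (simp add: map_pmf_comp state_of_def)
    also have "map_pmf (\<lambda>ct. ct v) (cond_pmf P ((\<lambda>ct. ct v) -` {0<..})) = cond_pmf (Q v) {0<..}"
      using ne unfolding component[OF v, symmetric] by (rule cond_map_pmf_vimage)
    also have "\<dots> = map_pmf (\<lambda>X. d v - X) (trunc_geometric_pmf p (d v))"
      unfolding Q_def using assms d by (intro cond_counter_iter_pos)
    \<comment> \<open>On the support \<open>X < d v\<close>, so subtraction of naturals agrees with
      that of integers.\<close>
    also have "map_pmf int \<dots> = map_pmf (\<lambda>X. int (d v) - int X) (trunc_geometric_pmf p (d v))"
      unfolding map_pmf_comp using assms d
      by (intro map_pmf_cong refl)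
        (auto simp: set_pmf_iff pmf_trunc_geometric of_nat_diff split: if_splits)
    finally show ?thesis .
  qed
  from prob indep cond show ?thesis
    by blast
qed

end
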